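(* Let $(X,\tau)$ be a topological space, let $\varphi_1,\varphi_2\in O(X,\tau)$, and let $\mathcal{B}=\{\varphi_2(U):U\in\varphi_1O(X)\}$. Suppose that ($\varphi_2\geq\varphi_1$ or $\varphi_2\geq\imath$), and that for each $U\in\varphi_1O(X)$ we have $\varphi_2(U)\in\varphi_1O(X)$ and $\varphi_2(\varphi_2(U))\subset\varphi_2(U)$. Then the following are equivalent: (a) $X$ is a $\varphi_{1,2}$-compact space. (b) $X$ is a $\mathcal{B}$-compact space. (c) $X$ is a $\varphi_{1,2}O(X)$-compact space. (d) For each $U\in\varphi_1O(X)$, $X\setminus\varphi_2(U)$ is a $\varphi_{1,2}$-compact set. (e) For each $U\in\varphi_1O(X)$, $X\setminus\varphi_2(U)$ is a $\varphi_{1,2}O(X)$-compact set. (f) For each $U\in\varphi_1O(X)$, $X\setminus\varphi_2(U)$ is a $\mathcal{B}$-compact set. (g) Each $\varphi_{1,2}$-closed set is a $\varphi_{1,2}$-compact set. (h) Each $\varphi_{1,2}$-closed set is a $\varphi_{1,2}O(X)$-compact set. (i) Each $\varphi_{1,2}$-closed set is a $\mathcal{B}$-compact set.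
   Context: Let $(X,\tau)$ be a topological space and let $A^{o}$ denote the interior of $A\subset X$. An operation on $(X,\tau)$ is a map $\varphi:P(X)\to P(X)$ with $A^{o}\subset\varphi(A)$ for all $A\in P(X)$ and $\varphi(\emptyset)=\emptyset$; $O(X,\tau)$ is the set of all operations, partially ordered by $\varphi\leq\psi$ iff $\varphi(A)\subset\psi(A)$ for all $A\in P(X)$. $\imath$ is the identity operation. A set $A\subset X$ is $\varphi$-open if $A\subset\varphi(A)$; $\varphi O(X)$ is the family of all $\varphi$-open sets. For $A\subset X$: $x\in\varphi_{1,2}\mathrm{int}\,A$ iff there is $U\in\varphi_1O(X)$ with $x\in U$ and $\varphi_2(U)\subset A$; $x\in\varphi_{1,2}\mathrm{cl}\,A$ iff $\varphi_2(U)\cap A\neq\emptyset$ for every $U\in\varphi_1O(X)$ with $x\in U$. $A$ is $\varphi_{1,2}$-open if $A\subset\varphi_{1,2}\mathrm{int}\,A$, and $\varphi_{1,2}$-closed if $\varphi_{1,2}\mathrm{cl}\,A\subset A$ (equivalently, $X\setminus A$ is $\varphi_{1,2}$-open). $\varphi_{1,2}O(X)$ is the family of $\varphi_{1,2}$-open sets. A set $A\subset X$ is a $\varphi_{1,2}$-compact set (relative to $X$) if every family $\mathcal{U}\subset\varphi_1O(X)$ with $A\subset\bigcup\mathcal{U}$ has a finite subfamily $\mathcal{U}'$ with $A\subset\bigcup\{\varphi_2(U):U\in\mathcal{U}'\}$. For a family $\mathcal{A}\subset P(X)$ with $X\in\mathcal{A}$, $A$ is an $\mathcal{A}$-compact set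 if every family $\mathcal{U}\subset\mathcal{A}$ with $A\subset\bigcup\mathcal{U}$ has a finite subfamily $\mathcal{U}'$ with $A\subset\bigcup\mathcal{U}'$. $X$ is a $\varphi_{1,2}$-compact (respectively $\mathcal{A}$-compact) space if the set $A=X$ is a $\varphi_{1,2}$-compact (respectively $\mathcal{A}$-compact) set. *)

theory Defs
  imports "HOL-Analysis.Abstract_Topology"
begin

text \<open>
  A space \<open>(X, \<tau>)\<close> is a value \<open>X :: 'a topology\<close>, with \<open>topspace X\<close> as its (possibly empty)
  point set. Maps \<open>P(X) \<rightarrow> P(X)\<close> are HOL functions on \<open>'a set\<close> constrained only on subsets of
  \<open>topspace X\<close>; every set quantified over below is such a subset, so values elsewhere play no role.
\<close>

definition operations :: "'a topology \<Rightarrow> ('a set \<Rightarrow> 'a set) set" where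
  "operations X =
     {\<phi> \<in> Pow (topspace X) \<rightarrow> Pow (topspace X).
        (\<forall>A \<subseteq> topspace X. X interior_of A \<subseteq> \<phi> A) \<and> \<phi> {} = {}}"

definition op_le :: "'a topology \<Rightarrow> ('a set \<Rightarrow> 'a set) \<Rightarrow> ('a set \<Rightarrow> 'a set) \<Rightarrow> bool" where
  "op_le X \<phi> \<psi> \<longleftrightarrow> (\<forall>A \<subseteq> topspace X. \<phi> A \<subseteq> \<psi> A)"

definition op_opens :: "'a topology \<Rightarrow> ('a set \<Rightarrow> 'a set) \<Rightarrow> 'a set set" where
  "op_opens X \<phi> = {A. A \<subseteq> topspace X \<and> A \<subseteq> \<phi> A}"

definition op2_interior ::
  "'a topology \<Rightarrow> ('a set \<Rightarrow> 'a set) \<Rightarrow> ('a set \<Rightarrow> 'a set) \<Rightarrow> 'a set \<Rightarrow> 'a set" where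
  "op2_interior X \<phi>1 \<phi>2 A = {x \<in> topspace X. \<exists>U \<in> op_opens X \<phi>1. x \<in> U \<and> \<phi>2 U \<subseteq> A}"

definition op2_closure ::
  "'a topology \<Rightarrow> ('a set \<Rightarrow> 'a set) \<Rightarrow> ('a set \<Rightarrow> 'a set) \<Rightarrow> 'a set \<Rightarrow> 'a set" where
  "op2_closure X \<phi>1 \<phi>2 A =
     {x \<in> topspace X. \<forall>U \<in> op_opens X \<phi>1. x \<in> U \<longrightarrow> \<phi>2 U \<inter> A \<noteq> {}}"

definition op2_opens ::
  "'a topology \<Rightarrow> ('a set \<Rightarrow> 'a set) \<Rightarrow> ('a set \<Rightarrow> 'a set) \<Rightarrow> 'a set set" where
  "op2_opens X \<phi>1 \<phi>2 = {A. A \<subseteq> topspace X \<and> A \<subseteq> op2_interior X \<phi>1 \<phi>2 A}"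

definition op2_closed ::
  "'a topology \<Rightarrow> ('a set \<Rightarrow> 'a set) \<Rightarrow> ('a set \<Rightarrow> 'a set) \<Rightarrow> 'a set \<Rightarrow> bool" where
  "op2_closed X \<phi>1 \<phi>2 A \<longleftrightarrow> A \<subseteq> topspace X \<and> op2_closure X \<phi>1 \<phi>2 A \<subseteq> A"

definition op2_compactin ::
  "'a topology \<Rightarrow> ('a set \<Rightarrow> 'a set) \<Rightarrow> ('a set \<Rightarrow> 'a set) \<Rightarrow> 'a set \<Rightarrow> bool" where
  "op2_compactin X \<phi>1 \<phi>2 A \<longleftrightarrow>
     A \<subseteq> topspace X \<and>
     (\<forall>\<U>. \<U> \<subseteq> op_opens X \<phi>1 \<and> A \<subseteq> \<Union>\<U> \<longrightarrow>
        (\<exists>\<V>. finite \<V> \<and> \<V> \<subseteq> \<U> \<and> A \<subseteq> (\<Union>U\<in>\<V>. \<phi>2 U)))"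

definition op2_compact_space ::
  "'a topology \<Rightarrow> ('a set \<Rightarrow> 'a set) \<Rightarrow> ('a set \<Rightarrow> 'a set) \<Rightarrow> bool" where
  "op2_compact_space X \<phi>1 \<phi>2 \<longleftrightarrow> op2_compactin X \<phi>1 \<phi>2 (topspace X)"

text \<open>
  Compactness relative to a family \<open>\<A>\<close> is intended only for \<open>\<A> \<subseteq> Pow (topspace X)\<close> with
  \<open>topspace X \<in> \<A>\<close>; the lemmas at the end establish this for the families of interest.
\<close>

definition family_compactin :: "'a topology \<Rightarrow> 'a set set \<Rightarrow> 'a set \<Rightarrow> bool" where
  "family_compactin X \<A> A \<longleftrightarrow>
     A \<subseteq> topspace X \<and>
     (\<forall>\<U>. \<U> \<subseteq> \<A> \<and> A \<subseteq> \<Union>\<U> \<longrightarrow> (\<exists>\<V>. finite \<V> \<and> \<V> \<subseteq> \<U> \<and> A \<subseteq> \<Union>\<V>))"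

definition family_compact_space :: "'a topology \<Rightarrow> 'a set set \<Rightarrow> bool" where
  "family_compact_space X \<A> \<longleftrightarrow> family_compactin X \<A> (topspace X)"

lemma operation_topspace:
  assumes "\<phi> \<in> operations X"
  shows "\<phi> (topspace X) = topspace X"
proof
  show "\<phi> (topspace X) \<subseteq> topspace X"
    using assms unfolding operations_def by blast
  have "X interior_of topspace X \<subseteq> \<phi> (topspace X)"
    using assms unfolding operations_def by blast
  then show "topspace X \<subseteq> \<phi> (topspace X)"
    by simp
qed

lemma topspace_in_op_opens:
  assumes "\<phi> \<in> operations X"
  shows "topspace X \<in> op_opens X \<phi>"
  using operation_topspace[OF assms] unfolding op_opens_def by simp

lemma image_op_opens_family:
  assumes "\<phi>1 \<in> operations X" and "\<phi>2 \<in> operations X"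
  shows "\<phi>2 ` op_opens X \<phi>1 \<subseteq> Pow (topspace X)"
    and "topspace X \<in> \<phi>2 ` op_opens X \<phi>1"
proof -
  show "\<phi>2 ` op_opens X \<phi>1 \<subseteq> Pow (topspace X)"
    using assms(2) unfolding operations_def op_opens_def by blast
  show "topspace X \<in> \<phi>2 ` op_opens X \<phi>1"
    using topspace_in_op_opens[OF assms(1)] operation_topspace[OF assms(2)] by (metis imageI)
qed

lemma op2_opens_family:
  assumes "\<phi>1 \<in> operations X" and "\<phi>2 \<in> operations X"
  shows "op2_opens X \<phi>1 \<phi>2 \<subseteq> Pow (topspace X)"
    and "topspace X \<in> op2_opens X \<phi>1 \<phi>2"
  using topspace_in_op_opens[OF assms(1)] operation_topspace[OF assms(2)]
  unfolding op2_opens_def op2_interior_def by auto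

end

(* The hypotheses give U \<subseteq> \<phi>2 U = \<phi>2 (\<phi>2 U) for each \<phi>1-open U, so the sets \<phi>2 U are themselves
   \<phi>1,2-open and form a base of the \<phi>1,2-open sets. Hence the three notions of compactness agree on
   every subset, and only two implications remain: a \<phi>1,2-closed subset of a compact space is
   compact (add its complement to a cover), and U = {} gives back the whole space in (d). *)

theory Submission
  imports Defs
begin

lemma op_image_subset:
  assumes "\<phi> \<in> operations X" and "A \<subseteq> topspace X"
  shows "\<phi> A \<subseteq> topspace X"
  using assms unfolding operations_def by blast

lemma op_empty:
  assumes "\<phi> \<in> operations X"
  shows "\<phi> {} = {}"
  using assms unfolding operations_def by blast

lemma op_opens_expand:
  assumes "op_le X \<phi>1 \<phi>2 \<or> op_le X id \<phi>2" and "U \<in> op_opens X \<phi>1"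
  shows "U \<subseteq> \<phi>2 U"
  using assms unfolding op_le_def op_opens_def by auto

text \<open>A point outside \<open>A\<close> is outside its closure, which supplies a \<phi>1-open
  \<open>U\<close> around it with \<open>\<phi>2 U\<close> disjoint from \<open>A\<close>. That
  \<open>\<phi>2\<close> is an operation keeps \<open>\<phi>2 U\<close> inside the space, hence
  inside the complement.\<close>

lemma op2_opens_diff_closed:
  assumes "\<phi>2 \<in> operations X" and "op2_closed X \<phi>1 \<phi>2 A"
  shows "topspace X - A \<in> op2_opens X \<phi>1 \<phi>2"
proof -
  have "\<exists>U \<in> op_opens X \<phi>1. x \<in> U \<and> \<phi>2 U \<subseteq> topspace X - A" if x: "x \<in> topspace X - A" for x
  proof -
    from x assms(2) obtain U where U: "U \<in> op_opens X \<phi>1" "x \<in> U" "\<phi>2 U \<inter> A = {}"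
      unfolding op2_closed_def op2_closure_def by blast
    moreover have "\<phi>2 U \<subseteq> topspace X"
      using U(1) by (intro op_image_subset[OF assms(1)]) (simp add: op_opens_def)
    ultimately show ?thesis by blast
  qed
  then show ?thesis
    unfolding op2_opens_def op2_interior_def by blast
qed

text \<open>A set \<open>U\<close> witnessing that a point is interior to \<open>A\<close> has
  \<open>\<phi>2 U\<close> disjoint from the complement, so the point is not in the closure of the
  complement.\<close>

lemma op2_closed_diff_opens:
  assumes "A \<in> op2_opens X \<phi>1 \<phi>2"
  shows "op2_closed X \<phi>1 \<phi>2 (topspace X - A)"
  using assms unfolding op2_closed_def op2_closure_def op2_opens_def op2_interior_def by blast

lemma family_compactin_mono:
  assumes "family_compactin X \<A> A" and "\<B> \<subseteq> \<A>"
  shows "family_compactin X \<B> A"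
  using assms unfolding family_compactin_def by blast

lemma family_compactin_closed_subset:
  assumes "family_compact_space X \<A>" and "A \<subseteq> topspace X" and "topspace X - A \<in> \<A>"
  shows "family_compactin X \<A> A"
  unfolding family_compactin_def
proof (intro conjI allI impI)
  fix \<U> assume \<U>: "\<U> \<subseteq> \<A> \<and> A \<subseteq> \<Union>\<U>"
  then have "insert (topspace X - A) \<U> \<subseteq> \<A>" "topspace X \<subseteq> \<Union>(insert (topspace X - A) \<U>)"
    using assms(3) by auto
  then obtain \<V> where \<V>: "finite \<V>" "\<V> \<subseteq> insert (topspace X - A) \<U>" "topspace X \<subseteq> \<Union>\<V>"
    using assms(1) unfolding family_compact_space_def family_compactin_def by meson
  \<comment> \<open>The added complement is disjoint from \<open>A\<close>, so dropping it still
    leaves \<open>A\<close> covered.\<close>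
  then have "finite (\<V> - {topspace X - A})" "\<V> - {topspace X - A} \<subseteq> \<U>"
    "A \<subseteq> \<Union>(\<V> - {topspace X - A})"
    using assms(2) by auto
  then show "\<exists>\<V>. finite \<V> \<and> \<V> \<subseteq> \<U> \<and> A \<subseteq> \<Union>\<V>" by blast
qed (fact assms(2))

text \<open>A cover by \<phi>1,2-open sets is refined by \<phi>1-open sets whose images under
  \<open>\<phi>2\<close> fit inside its members. Neither map has to be an operation here.\<close>

lemma op2_compactin_imp_family_compactin_opens:
  assumes "op2_compactin X \<phi>1 \<phi>2 A"
  shows "family_compactin X (op2_opens X \<phi>1 \<phi>2) A"
  unfolding family_compactin_def
proof (intro conjI allI impI)
  show "A \<subseteq> topspace X"
    using assms unfolding op2_compactin_def by blast
  fix \<W> assume \<W>: "\<W> \<subseteq> op2_opens X \<phi>1 \<phi>2 \<and> A \<subseteq> \<Union>\<W>"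
  define \<U> where "\<U> = {U \<in> op_opens X \<phi>1. \<exists>W \<in> \<W>. \<phi>2 U \<subseteq> W}"
  have "A \<subseteq> \<Union>\<U>"
  proof
    fix x assume "x \<in> A"
    then obtain W where W: "W \<in> \<W>" "x \<in> W" using \<W> by blast
    then have "x \<in> op2_interior X \<phi>1 \<phi>2 W" using \<W> unfolding op2_opens_def by blast
    then show "x \<in> \<Union>\<U>" using W unfolding op2_interior_def \<U>_def by blast
  qed
  moreover have "\<U> \<subseteq> op_opens X \<phi>1" unfolding \<U>_def by blast
  ultimately obtain \<V> where \<V>: "finite \<V>" "\<V> \<subseteq> \<U>" "A \<subseteq> (\<Union>U\<in>\<V>. \<phi>2 U)"
    using assms unfolding op2_compactin_def by meson
  from \<V>(2) have "\<forall>U \<in> \<V>. \<exists>W. W \<in> \<W> \<and> \<phi>2 U \<subseteq> W"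
    unfolding \<U>_def by blast
  \<comment> \<open>\<open>f\<close> chooses a member of the original cover around each
    \<open>\<phi>2 U\<close>, which turns the finite refinement into a finite subcover.\<close>
  then obtain f where f: "\<forall>U \<in> \<V>. f U \<in> \<W> \<and> \<phi>2 U \<subseteq> f U"
    by metis
  then have "finite (f ` \<V>)" "f ` \<V> \<subseteq> \<W>" "A \<subseteq> \<Union>(f ` \<V>)"
    using \<V> by (auto, blast)
  then show "\<exists>\<V>. finite \<V> \<and> \<V> \<subseteq> \<W> \<and> A \<subseteq> \<Union>\<V>" by blast
qed

text \<open>Since \<open>\<phi>2\<close> enlarges \<phi>1-open sets, the images of a cover again
  cover \<open>A\<close>; a finite subfamily of the images comes from finitely many members of the
  cover.\<close>

lemma family_compactin_image_imp_op2_compactin: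
  assumes "family_compactin X (\<phi>2 ` op_opens X \<phi>1) A"
    and "\<And>U. U \<in> op_opens X \<phi>1 \<Longrightarrow> U \<subseteq> \<phi>2 U"
  shows "op2_compactin X \<phi>1 \<phi>2 A"
  unfolding op2_compactin_def
proof (intro conjI allI impI)
  show "A \<subseteq> topspace X"
    using assms(1) unfolding family_compactin_def by blast
  fix \<U> assume \<U>: "\<U> \<subseteq> op_opens X \<phi>1 \<and> A \<subseteq> \<Union>\<U>"
  then have "\<phi>2 ` \<U> \<subseteq> \<phi>2 ` op_opens X \<phi>1" "A \<subseteq> \<Union>(\<phi>2 ` \<U>)"
    using assms(2) by blast+
  then obtain \<V> where "finite \<V>" "\<V> \<subseteq> \<phi>2 ` \<U>" "A \<subseteq> \<Union>\<V>"
    using assms(1) unfolding family_compactin_def by meson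
  then show "\<exists>\<V>. finite \<V> \<and> \<V> \<subseteq> \<U> \<and> A \<subseteq> (\<Union>U\<in>\<V>. \<phi>2 U)"
    by (metis finite_subset_image)
qed

theorem theorem3p7:
  fixes X :: "'a topology"
    and \<phi>1 \<phi>2 :: "'a set \<Rightarrow> 'a set"
    and \<B> :: "'a set set"
  assumes "\<phi>1 \<in> operations X" and "\<phi>2 \<in> operations X"
    and "\<B> = {\<phi>2 U |U. U \<in> op_opens X \<phi>1}"
    and "op_le X \<phi>1 \<phi>2 \<or> op_le X id \<phi>2"
    and "\<forall>U \<in> op_opens X \<phi>1. \<phi>2 U \<in> op_opens X \<phi>1 \<and> \<phi>2 (\<phi>2 U) \<subseteq> \<phi>2 U"
  shows
    "(op2_compact_space X \<phi>1 \<phi>2 \<longleftrightarrow> family_compact_space X \<B>) \<and>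
     (op2_compact_space X \<phi>1 \<phi>2 \<longleftrightarrow> family_compact_space X (op2_opens X \<phi>1 \<phi>2)) \<and>
     (op2_compact_space X \<phi>1 \<phi>2 \<longleftrightarrow>
        (\<forall>U \<in> op_opens X \<phi>1. op2_compactin X \<phi>1 \<phi>2 (topspace X - \<phi>2 U))) \<and>
     (op2_compact_space X \<phi>1 \<phi>2 \<longleftrightarrow>
        (\<forall>U \<in> op_opens X \<phi>1. family_compactin X (op2_opens X \<phi>1 \<phi>2) (topspace X - \<phi>2 U))) \<and>
     (op2_compact_space X \<phi>1 \<phi>2 \<longleftrightarrow>
        (\<forall>U \<in> op_opens X \<phi>1. family_compactin X \<B> (topspace X - \<phi>2 U))) \<and>
     (op2_compact_space X \<phi>1 \<phi>2 \<longleftrightarrow>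
        (\<forall>A. op2_closed X \<phi>1 \<phi>2 A \<longrightarrow> op2_compactin X \<phi>1 \<phi>2 A)) \<and>
     (op2_compact_space X \<phi>1 \<phi>2 \<longleftrightarrow>
        (\<forall>A. op2_closed X \<phi>1 \<phi>2 A \<longrightarrow> family_compactin X (op2_opens X \<phi>1 \<phi>2) A)) \<and>
     (op2_compact_space X \<phi>1 \<phi>2 \<longleftrightarrow>
        (\<forall>A. op2_closed X \<phi>1 \<phi>2 A \<longrightarrow> family_compactin X \<B> A))"
proof -
  have \<B>: "\<B> = \<phi>2 ` op_opens X \<phi>1"
    using assms(3) by blast
  have expand: "U \<subseteq> \<phi>2 U" if "U \<in> op_opens X \<phi>1" for U
    using op_opens_expand[OF assms(4) that] .
  \<comment> \<open>\<open>\<phi>2 U\<close> is its own witness at each of its points: it is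
    \<phi>1-open and \<open>\<phi>2\<close> maps it into itself.\<close>
  have \<phi>2_open: "\<phi>2 U \<in> op2_opens X \<phi>1 \<phi>2" if "U \<in> op_opens X \<phi>1" for U
    using assms(5) that unfolding op2_opens_def op2_interior_def op_opens_def by blast
  have opens_\<B>: "family_compactin X \<B> A" if "family_compactin X (op2_opens X \<phi>1 \<phi>2) A" for A
    using family_compactin_mono[OF that] \<phi>2_open unfolding \<B> by blast
  have \<B>_op2: "op2_compactin X \<phi>1 \<phi>2 A" if "family_compactin X \<B> A" for A
    using family_compactin_image_imp_op2_compactin expand that unfolding \<B> by blast
  \<comment> \<open>Both equivalences come from one cycle of implications:
    \<open>op2_compactin\<close>, then the \<phi>1,2-open family, then \<open>\<B>\<close>, then
    back.\<close>
  have opens_eq: "family_compactin X (op2_opens X \<phi>1 \<phi>2) A \<longleftrightarrow> op2_compactin X \<phi>1 \<phi>2 A" for A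
    using op2_compactin_imp_family_compactin_opens opens_\<B> \<B>_op2 by blast
  have \<B>_eq: "family_compactin X \<B> A \<longleftrightarrow> op2_compactin X \<phi>1 \<phi>2 A" for A
    using op2_compactin_imp_family_compactin_opens opens_\<B> \<B>_op2 by blast
  have closed_compact: "op2_compactin X \<phi>1 \<phi>2 A"
    if "op2_compact_space X \<phi>1 \<phi>2" and "op2_closed X \<phi>1 \<phi>2 A" for A
  proof -
    have "family_compact_space X (op2_opens X \<phi>1 \<phi>2)"
      using that(1) opens_eq unfolding op2_compact_space_def family_compact_space_def by blast
    moreover have "A \<subseteq> topspace X"
      using that(2) unfolding op2_closed_def by blast
    ultimately show ?thesis
      \<comment> \<open>The argument runs in the \<phi>1,2-open family because that family contains
        the complement of \<open>A\<close>.\<close>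
      using family_compactin_closed_subset op2_opens_diff_closed[OF assms(2) that(2)] opens_eq
      by blast
  qed
  have diff_closed: "op2_closed X \<phi>1 \<phi>2 (topspace X - \<phi>2 U)" if "U \<in> op_opens X \<phi>1" for U
    using op2_closed_diff_opens \<phi>2_open that by blast
  have "{} \<in> op_opens X \<phi>1"
    unfolding op_opens_def by blast
  then have space: "op2_compact_space X \<phi>1 \<phi>2"
    if "\<forall>U \<in> op_opens X \<phi>1. op2_compactin X \<phi>1 \<phi>2 (topspace X - \<phi>2 U)"
    using that op_empty[OF assms(2)] unfolding op2_compact_space_def by force
  have d: "op2_compact_space X \<phi>1 \<phi>2 \<longleftrightarrow>
      (\<forall>U \<in> op_opens X \<phi>1. op2_compactin X \<phi>1 \<phi>2 (topspace X - \<phi>2 U))"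
    using space closed_compact diff_closed by blast
  \<comment> \<open>The sets \<open>topspace X - \<phi>2 U\<close> are \<phi>1,2-closed, so (g)
    contains (d) as a special case.\<close>
  have g: "op2_compact_space X \<phi>1 \<phi>2 \<longleftrightarrow>
      (\<forall>A. op2_closed X \<phi>1 \<phi>2 A \<longrightarrow> op2_compactin X \<phi>1 \<phi>2 A)"
    using space closed_compact diff_closed by blast
  show ?thesis
    \<comment> \<open>Rewriting every compactness notion to \<open>op2_compactin\<close> makes (b)
      and (c) trivial and collapses (e), (f) into (d) and (h), (i) into (g).\<close>
    unfolding family_compact_space_def opens_eq \<B>_eq
    using d g by (simp add: op2_compact_space_def)
qed

end
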